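(* Let $d\in\mathbb N$, $a\in\mathbb N_0$, and let the generalized unsigned Lah numbers $L(d,a;n,m)$, $0\le m\le n$, be defined by the polynomial identities $$\mathrm{risefac}(d,a;x,n)=\sum_{m=0}^n L(d,a;n,m)\,\mathrm{fallfac}(d,a;x,m),\qquad n\in\mathbb N_0.$$ Then the infinite lower triangular matrix $\mathbf L[d,a]=(L(d,a;n,m))_{n,m\ge 0}$ is the Sheffer matrix $$\mathbf L[d,a]=\left((1-d\,t)^{-\frac{2a}{d}},\ \frac{t}{1-d\,t}\right).$$
   Context: $\mathbb N=\{1,2,\dots\}$, $\mathbb N_0=\{0,1,2,\dots\}$. Generalized rising and falling factorials: $\mathrm{risefac}(d,a;x,n):=\prod_{j=0}^{n-1}\big(x+(a+j\,d)\big)$ and $\mathrm{fallfac}(d,a;x,n):=\prod_{j=0}^{n-1}\big(x-(a+j\,d)\big)$, both equal to $1$ for $n=0$. For formal power series $g(t)$ with $g(0)\ne0$ and $f(t)=t\hat f(t)$ with $\hat f(0)\neq 0$, a lower triangular matrix $(S(n,m))_{n,m\ge0}$ is the Sheffer matrix $(g(t),f(t))$ if for every $m\in\mathbb N_0$ its column $m$ has exponential generating function $\sum_{n=m}^\infty S(n,m)\frac{t^n}{n!}=g(t)\,\frac{f(t)^m}{m!}$. *)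

theory Defs
  imports
    "HOL-Computational_Algebra.Polynomial"
    "HOL-Computational_Algebra.Formal_Power_Series"
begin

definition risefac :: "nat \<Rightarrow> nat \<Rightarrow> 'a::comm_ring_1 \<Rightarrow> nat \<Rightarrow> 'a" where
  "risefac d a x n = (\<Prod>j<n. x + of_nat (a + j * d))"

definition fallfac :: "nat \<Rightarrow> nat \<Rightarrow> 'a::comm_ring_1 \<Rightarrow> nat \<Rightarrow> 'a" where
  "fallfac d a x n = (\<Prod>j<n. x - of_nat (a + j * d))"

text \<open>
  The defining identities are identities in the polynomial ring: the factorials are taken at
  the indeterminate \<open>[:0, 1:]\<close>. The identities only involve the entries with \<open>m \<le> n\<close>;
  all entries above the diagonal are set to zero.
\<close>

definition is_gen_Lah :: "nat \<Rightarrow> nat \<Rightarrow> (nat \<Rightarrow> nat \<Rightarrow> rat) \<Rightarrow> bool" where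
  "is_gen_Lah d a L \<longleftrightarrow>
     (\<forall>n m. n < m \<longrightarrow> L n m = 0) \<and>
     (\<forall>n. risefac d a [:0, 1:] n = (\<Sum>m\<le>n. smult (L n m) (fallfac d a [:0, 1:] m)))"

definition gen_Lah :: "nat \<Rightarrow> nat \<Rightarrow> nat \<Rightarrow> nat \<Rightarrow> rat" where
  "gen_Lah d a = (THE L. is_gen_Lah d a L)"

lemma graded_basis_expansion:
  fixes p :: "nat \<Rightarrow> 'a::field poly"
  assumes deg: "\<And>m. degree (p m) = m" and lc: "\<And>m. coeff (p m) m \<noteq> 0"
    and "degree q \<le> n"
  shows "\<exists>c. q = (\<Sum>m\<le>n. smult (c m) (p m))"
  using \<open>degree q \<le> n\<close>
proof (induction n arbitrary: q)
  case 0
  have "q = smult (coeff q 0 / coeff (p 0) 0) (p 0)"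
  proof (rule poly_eqI)
    fix k show "coeff q k = coeff (smult (coeff q 0 / coeff (p 0) 0) (p 0)) k"
      using 0 lc[of 0] deg[of 0] by (cases k) (auto simp: coeff_eq_0)
  qed
  then show ?case by (intro exI[of _ "\<lambda>_. coeff q 0 / coeff (p 0) 0"]) simp
next
  case (Suc n)
  define b where "b = coeff q (Suc n) / coeff (p (Suc n)) (Suc n)"
  have "degree (q - smult b (p (Suc n))) \<le> n"
  proof (rule degree_le, intro allI impI)
    fix i assume "n < i"
    then consider "i = Suc n" | "i > Suc n" by linarith
    then show "coeff (q - smult b (p (Suc n))) i = 0"
      using Suc.prems lc[of "Suc n"] deg[of "Suc n"] by cases (auto simp: b_def coeff_eq_0)
  qed
  then obtain c where c: "q - smult b (p (Suc n)) = (\<Sum>m\<le>n. smult (c m) (p m))"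
    using Suc.IH by blast
  have "(\<Sum>m\<le>n. smult ((c(Suc n := b)) m) (p m)) = (\<Sum>m\<le>n. smult (c m) (p m))"
    by (rule sum.cong) auto
  then have "q = (\<Sum>m\<le>Suc n. smult ((c(Suc n := b)) m) (p m))"
    using c by (simp add: algebra_simps)
  then show ?case by blast
qed

lemma graded_basis_independent:
  fixes p :: "nat \<Rightarrow> 'a::field poly"
  assumes deg: "\<And>m. degree (p m) = m" and lc: "\<And>m. coeff (p m) m \<noteq> 0"
    and "(\<Sum>m\<le>n. smult (c m) (p m)) = 0" and "m \<le> n"
  shows "c m = 0"
  using assms(3,4)
proof (induction n arbitrary: m)
  case 0
  then show ?case using lc[of 0] by auto
next
  case (Suc n)
  have "coeff (\<Sum>m\<le>Suc n. smult (c m) (p m)) (Suc n) = c (Suc n) * coeff (p (Suc n)) (Suc n)"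
    using deg by (simp add: coeff_sum coeff_eq_0)
  with Suc.prems(1) lc[of "Suc n"] have top: "c (Suc n) = 0" by simp
  show ?case
  proof (cases "m = Suc n")
    case False
    with Suc.prems top Suc.IH show ?thesis by simp
  qed (use top in simp)
qed

lemma degree_lead_coeff_prod_shift:
  fixes b :: "nat \<Rightarrow> 'a::field"
  shows "degree (\<Prod>j<n. [:b j, 1:]) = n \<and> coeff (\<Prod>j<n. [:b j, 1:]) n = 1"
proof -
  have "degree (\<Prod>j<n. [:b j, 1:]) = n"
    by (subst degree_prod_eq_sum_degree) auto
  moreover have "lead_coeff (\<Prod>j<n. [:b j, 1:]) = 1"
    by (subst lead_coeff_prod) simp
  ultimately show ?thesis by simp
qed

lemma degree_risefac: "degree (risefac d a [:0, 1::rat:] n) = n"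
  using degree_lead_coeff_prod_shift[of "\<lambda>j. of_nat (a + j * d) :: rat" n]
  by (simp add: risefac_def of_nat_poly del: of_nat_add of_nat_mult)

lemma degree_lead_coeff_fallfac:
  "degree (fallfac d a [:0, 1::rat:] n) = n" "coeff (fallfac d a [:0, 1::rat:] n) n = 1"
  using degree_lead_coeff_prod_shift[of "\<lambda>j. - of_nat (a + j * d) :: rat" n]
  by (simp_all add: fallfac_def of_nat_poly del: of_nat_add of_nat_mult)

lemma ex1_gen_Lah: "\<exists>!L. is_gen_Lah d a L"
proof -
  define p where "p = fallfac d a [:0, 1::rat:]"
  have deg: "degree (p m) = m" and lc: "coeff (p m) m \<noteq> 0" for m
    by (simp_all add: p_def degree_lead_coeff_fallfac)
  have "\<exists>c. risefac d a [:0, 1::rat:] n = (\<Sum>m\<le>n. smult (c m) (p m))" for n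
    by (rule graded_basis_expansion[OF deg lc]) (simp add: degree_risefac)
  then obtain C where C: "\<And>n. risefac d a [:0, 1::rat:] n = (\<Sum>m\<le>n. smult (C n m) (p m))"
    by metis
  show ?thesis
  proof (rule ex_ex1I)
    have "is_gen_Lah d a (\<lambda>n m. if m \<le> n then C n m else 0)"
      using C by (simp add: is_gen_Lah_def p_def)
    then show "\<exists>L. is_gen_Lah d a L" by blast
  next
    fix L L' assume L: "is_gen_Lah d a L" and L': "is_gen_Lah d a L'"
    show "L = L'"
    proof (intro ext)
      fix n m
      have "(\<Sum>m\<le>n. smult (L n m - L' n m) (p m)) = 0"
        using L L' by (simp add: is_gen_Lah_def p_def smult_diff_left sum_subtractf)
      then have "m \<le> n \<Longrightarrow> L n m - L' n m = 0"
        by (rule graded_basis_independent[OF deg lc])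
      then show "L n m = L' n m"
        using L L' by (cases "m \<le> n") (auto simp: is_gen_Lah_def)
    qed
  qed
qed

lemma is_gen_Lah_gen_Lah: "is_gen_Lah d a (gen_Lah d a)"
  unfolding gen_Lah_def by (rule theI'[OF ex1_gen_Lah])

text \<open>
  For a power series \<open>F\<close> with constant coefficient 1, the power \<open>F\<^sup>c\<close> with arbitrary exponent
  \<open>c\<close> is the binomial series \<open>\<Sum>k. (c gchoose k) (F - 1)\<^sup>k\<close>. Other \<open>F\<close> are not meaningful.
\<close>

definition fps_gpow :: "'a::field_char_0 fps \<Rightarrow> 'a \<Rightarrow> 'a fps" where
  "fps_gpow F c = fps_binomial c oo (F - 1)"

definition is_Sheffer :: "(nat \<Rightarrow> nat \<Rightarrow> 'a::field_char_0) \<Rightarrow> 'a fps \<Rightarrow> 'a fps \<Rightarrow> bool" where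
  "is_Sheffer S g f \<longleftrightarrow>
     fps_nth g 0 \<noteq> 0 \<and>
     (\<exists>h. f = fps_X * h \<and> fps_nth h 0 \<noteq> 0) \<and>
     (\<forall>n m. n < m \<longrightarrow> S n m = 0) \<and>
     (\<forall>m. Abs_fps (\<lambda>n. S n m / fact n) = g * (fps_const (1 / fact m) * f ^ m))"

end

theory Submission
  imports Defs
begin

text \<open>
  Writing \<open>x + (a + n d) = (x - (a + m d)) + (2 a + (n + m) d)\<close> turns the defining identities
  into \<open>L(n+1, m) = L(n, m-1) + (2 a + (n + m) d) L(n, m)\<close>, which is solved by
  \<open>L(n, m) = binom(n, m) (2 a + m d) \<cdots> (2 a + (n - 1) d)\<close>. This is also \<open>n!/m!\<close> times the
  coefficient of \<open>t\<^sup>n\<close> in \<open>t\<^sup>m (1 - d t) powr (- 2 a/d - m)\<close>, by the binomial series.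
\<close>

definition Lah_closed :: "nat \<Rightarrow> nat \<Rightarrow> nat \<Rightarrow> nat \<Rightarrow> rat" where
  "Lah_closed d a n m = of_nat (n choose m) * (\<Prod>j=m..<n. of_nat (2 * a + j * d))"

lemma Lah_closed_above_diagonal: "n < m \<Longrightarrow> Lah_closed d a n m = 0"
  by (simp add: Lah_closed_def)

lemma Lah_closed_Suc_0:
  "Lah_closed d a (Suc n) 0 = of_nat (2 * a + n * d) * Lah_closed d a n 0"
  by (simp add: Lah_closed_def)

text \<open>For \<open>m < n\<close> all three products share the factor \<open>P\<close> over
  \<open>Suc m..<n\<close>. After Pascal's rule, what remains is \<open>d\<close> times the
  absorption identity \<open>(m + 1) * (n choose Suc m) = (n - m) * (n choose m)\<close>.\<close>

lemma Lah_closed_Suc_Suc: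
  "Lah_closed d a (Suc n) (Suc m) =
     Lah_closed d a n m + of_nat (2 * a + (n + Suc m) * d) * Lah_closed d a n (Suc m)"
proof (cases "m < n")
  case True
  define P :: rat where "P = (\<Prod>j=Suc m..<n. of_nat (2 * a + j * d))"
  have top: "(\<Prod>j=Suc m..<Suc n. of_nat (2 * a + j * d)) = P * of_nat (2 * a + n * d)"
    using True by (simp add: P_def)
  have bot: "(\<Prod>j=m..<n. of_nat (2 * a + j * d)) = of_nat (2 * a + m * d) * P"
    using True by (simp add: P_def prod.atLeast_Suc_lessThan)
  have "Suc m * (n choose Suc m) = (n - m) * (n choose m)"
    using binomial_absorb_comp[of n m] binomial_absorption[of m n] by simp
  then have "of_nat (Suc m) * of_nat (n choose Suc m) = (of_nat n - of_nat m) * (of_nat (n choose m) :: rat)"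
    using True by (metis less_imp_le of_nat_diff of_nat_mult)
  then have absorb: "(1 + of_nat m) * of_nat (n choose Suc m) = (of_nat n - of_nat m) * (of_nat (n choose m) :: rat)"
    by simp
  have "of_nat (Suc n choose Suc m) * of_nat (2 * a + n * d) =
      of_nat (n choose m) * of_nat (2 * a + m * d)
      + of_nat (2 * a + (n + Suc m) * d) * (of_nat (n choose Suc m) :: rat)"
    using arg_cong[OF absorb, of "\<lambda>x. x * of_nat d"] by (simp add: algebra_simps)
  then have "(of_nat (Suc n choose Suc m) * of_nat (2 * a + n * d)) * P =
      (of_nat (n choose m) * of_nat (2 * a + m * d)
      + of_nat (2 * a + (n + Suc m) * d) * of_nat (n choose Suc m)) * P"
    by (rule arg_cong)
  then show ?thesis
    unfolding Lah_closed_def top bot P_def[symmetric] by (simp only: algebra_simps)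
next
  case False
  then show ?thesis by (cases "m = n") (auto simp: Lah_closed_def)
qed

lemma risefac_expansion_Lah_closed:
  "risefac d a [:0, 1:] n = (\<Sum>m\<le>n. smult (Lah_closed d a n m) (fallfac d a [:0, 1:] m))"
proof (induction n)
  case 0
  then show ?case by (simp add: risefac_def fallfac_def Lah_closed_def)
next
  case (Suc n)
  define F where "F = fallfac d a [:0, 1 :: rat:]"
  define c where "c = (\<lambda>m. of_nat (2 * a + (n + m) * d) :: rat)"
  have shift: "F m * ([:0, 1:] + of_nat (a + n * d)) = F (Suc m) + smult (c m) (F m)" for m
  proof -
    have "[:0, 1 :: rat:] + of_nat (a + n * d) = ([:0, 1:] - of_nat (a + m * d)) + [:c m:]"
      by (simp add: of_nat_poly c_def algebra_simps)
    moreover have "F (Suc m) = F m * ([:0, 1:] - of_nat (a + m * d))"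
      by (simp add: F_def fallfac_def)
    moreover have "F m * [:c m:] = smult (c m) (F m)"
      by simp
    ultimately show ?thesis
      by (simp only: distrib_left)
  qed
  let ?L = "Lah_closed d a"
  have "risefac d a [:0, 1:] (Suc n) = risefac d a [:0, 1:] n * ([:0, 1:] + of_nat (a + n * d))"
    by (simp add: risefac_def)
  also have "\<dots> = (\<Sum>m\<le>n. smult (?L n m) (F m * ([:0, 1:] + of_nat (a + n * d))))"
    by (simp only: Suc.IH F_def sum_distrib_right mult_smult_left)
  also have "\<dots> = (\<Sum>m\<le>n. smult (?L n m) (F (Suc m))) + (\<Sum>m\<le>n. smult (c m * ?L n m) (F m))"
    by (simp only: shift smult_add_right smult_smult sum.distrib mult.commute[of "c _"])
  \<comment> \<open>The added term \<open>m = Suc n\<close> lies above the diagonal and vanishes.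
    Splitting off \<open>m = 0\<close> next leaves a sum over \<open>F (Suc m)\<close> with
    \<open>m \<le> n\<close>, matching the first sum, so the recurrence applies termwise.\<close>
  also have "(\<Sum>m\<le>n. smult (c m * ?L n m) (F m)) = (\<Sum>m\<le>Suc n. smult (c m * ?L n m) (F m))"
    by (simp add: Lah_closed_above_diagonal)
  also have "\<dots> = smult (c 0 * ?L n 0) (F 0) + (\<Sum>m\<le>n. smult (c (Suc m) * ?L n (Suc m)) (F (Suc m)))"
    by (rule sum.atMost_Suc_shift)
  also have "(\<Sum>m\<le>n. smult (?L n m) (F (Suc m))) + \<dots> =
      smult (?L (Suc n) 0) (F 0) + (\<Sum>m\<le>n. smult (?L (Suc n) (Suc m)) (F (Suc m)))"
    by (simp add: Lah_closed_Suc_0 Lah_closed_Suc_Suc c_def smult_add_left sum.distrib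
        del: of_nat_add of_nat_mult)
  also have "\<dots> = (\<Sum>m\<le>Suc n. smult (?L (Suc n) m) (F m))"
    by (rule sum.atMost_Suc_shift[symmetric])
  finally show ?case by (simp only: F_def)
qed

lemma gen_Lah_eq_Lah_closed: "gen_Lah d a = Lah_closed d a"
proof -
  have "is_gen_Lah d a (Lah_closed d a)"
    unfolding is_gen_Lah_def
    using Lah_closed_above_diagonal risefac_expansion_Lah_closed by blast
  with is_gen_Lah_gen_Lah ex1_gen_Lah show ?thesis by blast
qed

lemma fps_gpow_linear:
  "fps_gpow (1 - fps_const k * fps_X) c = fps_binomial c oo (fps_const (- k) * fps_X)"
  by (simp add: fps_gpow_def flip: fps_const_neg)

lemma fps_nth_gpow_linear:
  "fps_nth (fps_gpow (1 - fps_const k * fps_X) c) n = (- k) ^ n * (c gchoose n)"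
  by (simp only: fps_gpow_linear fps_nth_compose_linear fps_binomial_nth)

text \<open>The exponent law for binomial series survives substituting \<open>- k * X\<close>. It
  merges \<open>g\<close> and the denominator of \<open>f ^ m\<close> into one power.\<close>

lemma fps_gpow_linear_add:
  "fps_gpow (1 - fps_const k * fps_X) (b + c) =
     fps_gpow (1 - fps_const k * fps_X) b * fps_gpow (1 - fps_const k * fps_X) c"
  by (simp add: fps_gpow_linear fps_binomial_add_mult fps_compose_mult_distrib)

text \<open>Exponent 1 gives back the series itself, so by the exponent law exponent -1 gives its
  inverse; induction on \<open>m\<close> does the rest.\<close>

lemma fps_gpow_linear_minus_of_nat:
  "fps_gpow (1 - fps_const k * fps_X) (- of_nat m) = inverse (1 - fps_const k * fps_X) ^ m"
proof (induction m)
  case 0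
  then show ?case by (simp add: fps_gpow_linear)
next
  case (Suc m)
  let ?u = "1 - fps_const k * fps_X"
  have "fps_gpow ?u 1 = ?u"
    by (simp add: fps_gpow_linear fps_binomial_1 fps_compose_add_distrib flip: fps_const_neg)
  moreover have "fps_gpow ?u (- 1) * fps_gpow ?u 1 = 1"
    using fps_gpow_linear_add[of k "- 1" 1] by (simp add: fps_gpow_linear)
  ultimately have "fps_gpow ?u (- 1) = inverse ?u"
    by (metis fps_inverse_unique mult.commute)
  moreover have "fps_gpow ?u (- of_nat (Suc m)) = fps_gpow ?u (- 1) * fps_gpow ?u (- of_nat m)"
    by (simp flip: fps_gpow_linear_add)
  ultimately show ?case using Suc.IH by simp
qed

text \<open>Negating the upper argument turns the binomial into a rising factorial, with a sign that
  cancels the one in \<open>(- k) ^ n\<close>. Each factor then absorbs one \<open>k\<close>: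
  \<open>k * (b / k + j) = b + j * k\<close>.\<close>

lemma power_mult_gbinomial_eq_prod:
  fixes k b :: "'a::field_char_0"
  assumes "k \<noteq> 0"
  shows "(- k) ^ n * ((- (b / k)) gchoose n) = (\<Prod>j<n. b + of_nat j * k) / fact n"
proof -
  have "(- k) ^ n * ((- (b / k)) gchoose n) = k ^ n * pochhammer (b / k) n / fact n"
    by (simp add: gbinomial_pochhammer power_minus[of k])
  also have "k ^ n * pochhammer (b / k) n = (\<Prod>j<n. k * (b / k + of_nat j))"
    by (simp add: pochhammer_prod prod.distrib atLeast0LessThan)
  also have "\<dots> = (\<Prod>j<n. b + of_nat j * k)"
    using assms by (intro prod.cong) (auto simp: field_simps)
  finally show ?thesis .
qed

theorem mainTheorem20:
  fixes d a :: nat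
  assumes "d \<ge> 1"
  shows "is_Sheffer (gen_Lah d a)
           (fps_gpow (1 - fps_const (of_nat d) * fps_X) (- (2 * of_nat a / of_nat d)))
           (fps_X / (1 - fps_const (of_nat d) * fps_X))"
proof -
  define k :: rat where "k = of_nat d"
  have k: "k \<noteq> 0" using assms by (simp add: k_def)
  define u where "u = 1 - fps_const k * fps_X"
  define g where "g = fps_gpow u (- (2 * of_nat a / k))"
  have f: "fps_X / u = fps_X * inverse u"
    by (simp add: u_def fps_divide_unit)
  have "fps_nth g 0 \<noteq> 0"
    by (simp add: g_def u_def fps_nth_gpow_linear)
  moreover have "\<exists>h. fps_X / u = fps_X * h \<and> fps_nth h 0 \<noteq> 0"
    using f by (intro exI[of _ "inverse u"]) (simp add: u_def)
  moreover have "Abs_fps (\<lambda>n. Lah_closed d a n m / fact n) =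
      g * (fps_const (1 / fact m) * (fps_X / u) ^ m)" for m
  proof (rule fps_ext)
    fix n
    \<comment> \<open>The total exponent \<open>- 2 a / k - m\<close>, written over the single
      denominator \<open>k\<close> so that \<open>power_mult_gbinomial_eq_prod\<close> applies with
      \<open>b = 2 a + m k\<close>.\<close>
    define c where "c = - ((2 * of_nat a + of_nat m * k) / k)"
    have "g * inverse u ^ m = fps_gpow u (- (2 * of_nat a / k) + - of_nat m)"
      unfolding g_def u_def fps_gpow_linear_add fps_gpow_linear_minus_of_nat ..
    also have "- (2 * of_nat a / k) + - of_nat m = c"
      using k by (simp add: c_def field_simps)
    finally have "g * (fps_const (1 / fact m) * (fps_X / u) ^ m) =
        fps_const (1 / fact m) * (fps_X ^ m * fps_gpow u c)"
      by (simp add: f power_mult_distrib mult_ac)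
    \<comment> \<open>The factor \<open>X ^ m\<close> shifts the coefficients by
      \<open>m\<close>.\<close>
    then have rhs: "fps_nth (g * (fps_const (1 / fact m) * (fps_X / u) ^ m)) n =
        (if n < m then 0 else fps_nth (fps_gpow u c) (n - m) / fact m)"
      by (simp only: fps_mult_left_const_nth fps_X_power_mult_nth) simp
    show "fps_nth (Abs_fps (\<lambda>n. Lah_closed d a n m / fact n)) n =
        fps_nth (g * (fps_const (1 / fact m) * (fps_X / u) ^ m)) n"
    proof (cases "n < m")
      case True
      then show ?thesis using rhs by (simp add: Lah_closed_above_diagonal)
    next
      case False
      then have "m \<le> n" by simp
      have "fps_nth (fps_gpow u c) (n - m) =
          (\<Prod>j<n - m. 2 * of_nat a + of_nat m * k + of_nat j * k) / fact (n - m)"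
        unfolding u_def fps_nth_gpow_linear c_def by (rule power_mult_gbinomial_eq_prod[OF k])
      \<comment> \<open>Shifting the index by \<open>m\<close> absorbs the summand
        \<open>m k\<close> of \<open>b\<close>.\<close>
      also have "(\<Prod>j<n - m. 2 * of_nat a + of_nat m * k + of_nat j * k) =
          (\<Prod>j=m..<n. of_nat (2 * a + j * d))"
        using \<open>m \<le> n\<close>
        by (intro prod.reindex_bij_witness[of _ "\<lambda>j. j - m" "\<lambda>j. j + m"])
           (auto simp: k_def algebra_simps)
      \<comment> \<open>The factorials agree because \<open>(n choose m) / n!\<close> equals
        \<open>1 / (m! (n - m)!)\<close>.\<close>
      finally show ?thesis
        using rhs False \<open>m \<le> n\<close> by (simp add: Lah_closed_def binomial_fact del: of_nat_add of_nat_mult)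
    qed
  qed
  ultimately have "is_Sheffer (Lah_closed d a) g (fps_X / u)"
    by (auto simp: is_Sheffer_def Lah_closed_above_diagonal)
  then show ?thesis
    by (simp add: gen_Lah_eq_Lah_closed g_def u_def k_def)
qed

end
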